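(* For the integral covering graph $D(1,1)$ of the vector $(1,1)$ we have $\mathrm{box}(D(1,1))=\dim_{TH}(D(1,1))=0$. For every integer $m\ge 1$, the integral covering graph $D(m)$ of the one-entry vector $(m)$ satisfies \[\mathrm{box}(D(m))=\dim_{TH}(D(m))=\begin{cases}0 & \text{if } m\le 3,\\ 1 & \text{if } m\ge 4.\end{cases}\]
   Context: $[m]_0=\{0,1,\dots,m\}$. For $\bm{m}=(m_1,\dots,m_n)\in\mathbb{Z}_{\ge 1}^n$, the integral covering graph $D(\bm{m})$ has vertex set $\prod_{i=1}^n [m_i]_0\setminus\{\bm{0},\bm{m}\}$, where $\bm 0$ is the all-zero vector, and two distinct vertices $\bm v,\bm w$ are adjacent iff $v_i+w_i\ge m_i$ for all $i$. The boxicity $\mathrm{box}(G)$ of a finite simple graph $G$ is the minimum integer $d\ge 0$ such that there exist $d$ interval graphs $I_1,\dots,I_d$ on $V(G)$ with $E(G)=\bigcap_{j=1}^d E(I_j)$. For a finite set $V$, $\alpha\colon V\to\mathbb{R}$ and $S\in\mathbb{R}$, the threshold graph $T(\alpha,S)$ has vertex set $V$ and edges all $\{v,w\}$, $v\neq w$, with $\alpha(v)+\alpha(w)\ge S$; a graph is a threshold graph if it is of this form. The threshold dimension $\dim_{TH}(G)$ is the minimum $d\ge 0$ such that there exist $d$ threshold graphs $H_1,\dots,H_d$ on $V(G)$ with $E(G)=\bigcap_{j=1}^d E(H_j)$. In both definitions the empty intersection ($d=0$) is the set of all pairs of vertices, so the parameter is $0$ exactly for complete graphs (including the graph with no vertices).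 *)

theory Defs
  imports Complex_Main
begin

record 'a ugraph =
  verts :: "'a set"
  edges :: "'a set set"

definition all_pairs :: "'a set \<Rightarrow> 'a set set" where
  "all_pairs V = {{v, w} | v w. v \<in> V \<and> w \<in> V \<and> v \<noteq> w}"

definition simple_graph :: "'a ugraph \<Rightarrow> bool" where
  "simple_graph G \<longleftrightarrow> finite (verts G) \<and> edges G \<subseteq> all_pairs (verts G)"

(* Intersection graph of the nonempty compact real intervals [l v, r v]. For finite graphs,
   allowing arbitrary real intervals gives the same class. *)
definition interval_graph :: "'a ugraph \<Rightarrow> bool" where
  "interval_graph H \<longleftrightarrow> finite (verts H) \<and>
     (\<exists>l r :: 'a \<Rightarrow> real. (\<forall>v \<in> verts H. l v \<le> r v) \<and>
        edges H = {{v, w} | v w. v \<in> verts H \<and> w \<in> verts H \<and> v \<noteq> w \<and>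
                     {l v..r v} \<inter> {l w..r w} \<noteq> {}})"

definition T_graph :: "'a set \<Rightarrow> ('a \<Rightarrow> real) \<Rightarrow> real \<Rightarrow> 'a ugraph" where
  "T_graph V \<alpha> S =
     \<lparr>verts = V, edges = {{v, w} | v w. v \<in> V \<and> w \<in> V \<and> v \<noteq> w \<and> \<alpha> v + \<alpha> w \<ge> S}\<rparr>"

definition threshold_graph :: "'a ugraph \<Rightarrow> bool" where
  "threshold_graph H \<longleftrightarrow> finite (verts H) \<and> (\<exists>\<alpha> S. H = T_graph (verts H) \<alpha> S)"

(* For d > 0 intersecting with all_pairs is redundant, as members of the classes used below only
   have edges in all_pairs; for d = 0 it makes the empty intersection the set of all pairs. *)
definition is_intersection_of ::
  "('a ugraph \<Rightarrow> bool) \<Rightarrow> nat \<Rightarrow> 'a ugraph \<Rightarrow> bool" where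
  "is_intersection_of P d G \<longleftrightarrow>
     (\<exists>H :: nat \<Rightarrow> 'a ugraph. (\<forall>j<d. P (H j) \<and> verts (H j) = verts G) \<and>
        edges G = all_pairs (verts G) \<inter> (\<Inter>j<d. edges (H j)))"

(* Both minima exist for every finite simple graph: see ex_intersection_interval and
   ex_intersection_threshold. *)
definition boxicity :: "'a ugraph \<Rightarrow> nat" where
  "boxicity G = (LEAST d. is_intersection_of interval_graph d G)"

definition threshold_dim :: "'a ugraph \<Rightarrow> nat" where
  "threshold_dim G = (LEAST d. is_intersection_of threshold_graph d G)"

(* Integer vectors of length n are lists of length n. *)
definition covering_graph :: "nat list \<Rightarrow> nat list ugraph" where
  "covering_graph m =
     (let V = {v. length v = length m \<and> (\<forall>i<length m. v ! i \<le> m ! i)}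
                - {replicate (length m) 0, m}
      in \<lparr>verts = V,
          edges = {{v, w} | v w. v \<in> V \<and> w \<in> V \<and> v \<noteq> w \<and>
                     (\<forall>i<length m. v ! i + w ! i \<ge> m ! i)}\<rparr>)"

lemma simple_covering_graph: "simple_graph (covering_graph m)"
proof -
  have "{v. length v = length m \<and> (\<forall>i<length m. v ! i \<le> m ! i)}
          \<subseteq> {v. set v \<subseteq> {..sum_list m} \<and> length v = length m}"
  proof (clarsimp simp: set_conv_nth)
    fix v :: "nat list" and i
    assume "length v = length m" "\<forall>i<length m. v ! i \<le> m ! i" "i < length m"
    then show "v ! i \<le> sum_list m"
      using member_le_sum_list[of "m ! i" m] by fastforce
  qed
  then have "finite {v. length v = length m \<and> (\<forall>i<length m. v ! i \<le> m ! i)}"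
    by (rule finite_subset) (rule finite_lists_length_eq, rule finite_atMost)
  then show ?thesis
    by (auto simp: simple_graph_def covering_graph_def all_pairs_def Let_def)
qed

lemma ex_intersection:
  assumes G: "simple_graph G"
    and P: "\<And>a b. a \<in> verts G \<Longrightarrow> b \<in> verts G \<Longrightarrow> a \<noteq> b \<Longrightarrow>
              P \<lparr>verts = verts G, edges = all_pairs (verts G) - {{a, b}}\<rparr>"
  shows "\<exists>d. is_intersection_of P d G"
proof -
  let ?N = "all_pairs (verts G) - edges G"
  have "all_pairs (verts G) \<subseteq> Pow (verts G)"
    by (auto simp: all_pairs_def)
  then have "finite ?N"
    using G by (meson simple_graph_def finite_Diff finite_Pow_iff finite_subset)
  then obtain n and f :: "nat \<Rightarrow> 'a set" where f: "?N = f ` {i. i < n}"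
    by (metis finite_imp_nat_seg_image_inj_on)
  define H where "H = (\<lambda>j. \<lparr>verts = verts G, edges = all_pairs (verts G) - {f j}\<rparr>)"
  have "P (H j)" if "j < n" for j
  proof -
    have "f j \<in> ?N" unfolding f using that by simp
    then obtain a b where "f j = {a, b}" "a \<in> verts G" "b \<in> verts G" "a \<noteq> b"
      by (auto simp: all_pairs_def)
    then show ?thesis using P by (simp add: H_def)
  qed
  moreover have "edges G = all_pairs (verts G) - ?N"
    using G by (auto simp: simple_graph_def)
  then have "edges G = all_pairs (verts G) \<inter> (\<Inter>j<n. edges (H j))"
    unfolding f by (auto simp: H_def)
  ultimately have "is_intersection_of P n G"
    unfolding is_intersection_of_def by (intro exI[of _ H]) (simp add: H_def)
  then show ?thesis ..
qed

lemma all_pairs_minus: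
  assumes "\<And>v w. v \<noteq> w \<Longrightarrow> Q v w \<longleftrightarrow> {v, w} \<noteq> e"
  shows "all_pairs V - {e} = {{v, w} | v w. v \<in> V \<and> w \<in> V \<and> v \<noteq> w \<and> Q v w}"
  unfolding all_pairs_def using assms by auto

lemma ex_intersection_interval:
  assumes "simple_graph G"
  shows "\<exists>d. is_intersection_of interval_graph d G"
proof (rule ex_intersection[OF assms])
  fix a b assume "a \<in> verts G" "b \<in> verts G" "a \<noteq> b"
  let ?l = "\<lambda>v. if v = b then 1 else 0 :: real" and ?r = "\<lambda>v. if v = a then 0 else 1 :: real"
  have meet: "{?l v..?r v} \<inter> {?l w..?r w} \<noteq> {} \<longleftrightarrow> {v, w} \<noteq> {a, b}" if "v \<noteq> w" for v w
    using that \<open>a \<noteq> b\<close> by (auto simp: doubleton_eq_iff)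
  have "all_pairs (verts G) - {{a, b}} = {{v, w} | v w. v \<in> verts G \<and> w \<in> verts G \<and> v \<noteq> w \<and>
          {?l v..?r v} \<inter> {?l w..?r w} \<noteq> {}}"
    by (rule all_pairs_minus) (rule meet)
  moreover have "\<forall>v \<in> verts G. ?l v \<le> ?r v"
    using \<open>a \<noteq> b\<close> by auto
  moreover have "finite (verts G)"
    using assms by (simp add: simple_graph_def)
  ultimately show "interval_graph \<lparr>verts = verts G, edges = all_pairs (verts G) - {{a, b}}\<rparr>"
    unfolding interval_graph_def ugraph.simps
    by (intro conjI exI[of _ ?l] exI[of _ ?r])
qed

lemma ex_intersection_threshold:
  assumes "simple_graph G"
  shows "\<exists>d. is_intersection_of threshold_graph d G"
proof (rule ex_intersection[OF assms])
  fix a b assume "a \<in> verts G" "b \<in> verts G" "a \<noteq> b"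
  let ?\<alpha> = "\<lambda>v. if v \<in> {a, b} then 0 else 1 :: real"
  have adj: "?\<alpha> v + ?\<alpha> w \<ge> 1 \<longleftrightarrow> {v, w} \<noteq> {a, b}" if "v \<noteq> w" for v w
    using that by (auto simp: doubleton_eq_iff)
  have "all_pairs (verts G) - {{a, b}} =
          {{v, w} | v w. v \<in> verts G \<and> w \<in> verts G \<and> v \<noteq> w \<and> ?\<alpha> v + ?\<alpha> w \<ge> 1}"
    by (rule all_pairs_minus) (rule adj)
  then have "\<lparr>verts = verts G, edges = all_pairs (verts G) - {{a, b}}\<rparr> = T_graph (verts G) ?\<alpha> 1"
    by (simp only: T_graph_def)
  moreover have "finite (verts G)"
    using assms by (simp add: simple_graph_def)
  ultimately show "threshold_graph \<lparr>verts = verts G, edges = all_pairs (verts G) - {{a, b}}\<rparr>"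
    unfolding threshold_graph_def ugraph.simps by blast
qed

end

theory Submission
  imports Defs
begin

text \<open>
  The graph \<open>D(m)\<close> has vertices \<open>1, \<dots>, m - 1\<close> and is itself a threshold graph, with the
  identity as weight. A threshold graph with pairwise distinct weights is an interval graph: a
  vertex of weight \<open>a < S / 2\<close> becomes the point \<open>a\<close>, all others become \<open>[S - a, S / 2]\<close>.
  So both parameters are at most \<open>1\<close>, and they vanish iff \<open>D(m)\<close> is complete. The least
  sum of two distinct vertices is \<open>1 + 2\<close>, so this means \<open>m \<le> 3\<close>.
\<close>

lemma is_intersection_of_0: "is_intersection_of P 0 G \<longleftrightarrow> edges G = all_pairs (verts G)"
  by (simp add: is_intersection_of_def)

lemma is_intersection_of_1:
  assumes "P G" "edges G \<subseteq> all_pairs (verts G)"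
  shows "is_intersection_of P 1 G"
  unfolding is_intersection_of_def by (rule exI[of _ "\<lambda>_. G"]) (use assms in auto)

text \<open>The family consisting of \<open>G\<close> alone shows that \<open>d = 1\<close>
  suffices, and \<open>d = 0\<close> is possible only for complete graphs. Since \<open>P\<close> is
  arbitrary, this serves both parameters.\<close>

lemma Least_is_intersection_of:
  assumes "P G" "simple_graph G"
  shows "(LEAST d. is_intersection_of P d G) = (if edges G = all_pairs (verts G) then 0 else 1)"
proof (cases "edges G = all_pairs (verts G)")
  case True
  then show ?thesis by (simp add: is_intersection_of_0)
next
  case False
  have "is_intersection_of P 1 G"
    using assms by (intro is_intersection_of_1) (simp_all add: simple_graph_def)
  moreover have "1 \<le> d" if "is_intersection_of P d G" for d
    using that False by (cases d) (auto simp: is_intersection_of_0)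
  ultimately show ?thesis
    using False by (simp add: Least_equality)
qed

lemma threshold_graph_T_graph: "finite V \<Longrightarrow> threshold_graph (T_graph V \<alpha> S)"
  by (auto simp: threshold_graph_def T_graph_def)

text \<open>Two vertices of weight at least \<open>S / 2\<close> share the point
  \<open>S / 2\<close>. A point \<open>a < S / 2\<close> lies in \<open>[S - b, S / 2]\<close> iff
  \<open>a + b \<ge> S\<close>. Two weights below \<open>S / 2\<close> have sum below
  \<open>S\<close>, and injectivity keeps their points apart.\<close>

lemma interval_graph_T_graph:
  assumes "finite V" "inj_on \<alpha> V"
  shows "interval_graph (T_graph V \<alpha> S)"
proof -
  \<comment> \<open>Each \<open>min\<close> covers both kinds of vertices at once, since
    \<open>\<alpha> v \<le> S - \<alpha> v\<close> iff
    \<open>\<alpha> v \<le> S / 2\<close>.\<close>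
  let ?l = "\<lambda>v. min (\<alpha> v) (S - \<alpha> v)" and ?r = "\<lambda>v. min (\<alpha> v) (S / 2)"
  have meet: "{?l v..?r v} \<inter> {?l w..?r w} \<noteq> {} \<longleftrightarrow> \<alpha> v + \<alpha> w \<ge> S"
    if "v \<in> V" "w \<in> V" "v \<noteq> w" for v w
  proof -
    have "\<alpha> v \<noteq> \<alpha> w"
      using that assms by (auto dest: inj_onD)
    \<comment> \<open>Nonempty closed intervals meet iff the larger left end is at most the smaller
      right end, which leaves linear arithmetic with case splits.\<close>
    then have "max (?l v) (?l w) \<le> min (?r v) (?r w) \<longleftrightarrow> \<alpha> v + \<alpha> w \<ge> S"
      by linarith
    then show ?thesis
      by (simp del: max.bounded_iff min.bounded_iff)
  qed
  have "edges (T_graph V \<alpha> S) = {{v, w} | v w. v \<in> V \<and> w \<in> V \<and> v \<noteq> w \<and>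
          {?l v..?r v} \<inter> {?l w..?r w} \<noteq> {}}"
    using meet by (simp add: T_graph_def cong: conj_cong)
  moreover have "\<forall>v \<in> V. ?l v \<le> ?r v"
    by (simp add: min_def)
  ultimately show ?thesis
    using assms(1) unfolding interval_graph_def
    by (intro conjI exI[of _ ?l] exI[of _ ?r]) (simp_all only: T_graph_def ugraph.simps)
qed

lemma covering_graph_singleton:
  "covering_graph [m] = T_graph ((\<lambda>k. [k]) ` {0<..<m}) (\<lambda>v. real (hd v)) (real m)"
proof -
  have V: "{v. length v = length [m] \<and> (\<forall>i<length [m]. v ! i \<le> [m] ! i)}
             - {replicate (length [m]) 0, [m]} = (\<lambda>k. [k]) ` {0<..<m}"
    by (auto simp: length_Suc_conv)
  have adj: "(\<forall>i<length [m]. v ! i + w ! i \<ge> [m] ! i) \<longleftrightarrow> real (hd v) + real (hd w) \<ge> real m"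
    if "v \<in> (\<lambda>k. [k]) ` {0<..<m}" "w \<in> (\<lambda>k. [k]) ` {0<..<m}" for v w
    using that by (auto simp flip: of_nat_add)
  show ?thesis
    unfolding covering_graph_def Let_def V T_graph_def by (simp only: adj cong: conj_cong)
qed

lemma covering_graph_singleton_complete_iff:
  "edges (covering_graph [m]) = all_pairs (verts (covering_graph [m])) \<longleftrightarrow> m \<le> 3"
proof
  assume complete: "edges (covering_graph [m]) = all_pairs (verts (covering_graph [m]))"
  show "m \<le> 3"
  proof (rule ccontr)
    assume "\<not> m \<le> 3"
    then have "[1] \<in> verts (covering_graph [m])" "[2] \<in> verts (covering_graph [m])"
      by (auto simp: covering_graph_singleton T_graph_def)
    then have "{[1], [2]} \<in> all_pairs (verts (covering_graph [m]))"
      unfolding all_pairs_def by force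
    then have "{[1], [2]} \<in> edges (covering_graph [m])"
      using complete by simp
    with \<open>\<not> m \<le> 3\<close> show False
      by (auto simp: covering_graph_singleton T_graph_def doubleton_eq_iff)
  qed
next
  assume "m \<le> 3"
  \<comment> \<open>Two distinct positive integers add up to at least 3, hence to at least
    \<open>m\<close>.\<close>
  then have "real (hd v) + real (hd w) \<ge> real m"
    if "v \<in> (\<lambda>k. [k]) ` {0<..<m}" "w \<in> (\<lambda>k. [k]) ` {0<..<m}" "v \<noteq> w" for v w
    using that by auto
  then show "edges (covering_graph [m]) = all_pairs (verts (covering_graph [m]))"
    by (simp add: covering_graph_singleton T_graph_def all_pairs_def cong: conj_cong)
qed

lemma edges_covering_graph_1_1:
  "edges (covering_graph [1, 1]) = all_pairs (verts (covering_graph [1, 1]))"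
proof -
  have V: "{v. length v = length [1, 1] \<and> (\<forall>i<length [1, 1]. v ! i \<le> [1, 1] ! i)}
          - {replicate (length [1, 1]) 0, [1, 1]} = {[0, 1], [1, 0 :: nat]}"
    by (auto simp: length_Suc_conv All_less_Suc le_Suc_eq numeral_2_eq_2)
  \<comment> \<open>Distinct \<open>v\<close> and \<open>w\<close> are the two unit vectors, whose
    sum is 1 in each coordinate.\<close>
  have adj: "(v \<in> {[0, 1], [1, 0]} \<and> w \<in> {[0, 1], [1, 0]} \<and> v \<noteq> w \<and>
      (\<forall>i<length [1, 1]. v ! i + w ! i \<ge> [1, 1 :: nat] ! i)) \<longleftrightarrow>
    (v \<in> {[0, 1], [1, 0]} \<and> w \<in> {[0, 1], [1, 0]} \<and> v \<noteq> w)" for v w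
    by (auto simp: All_less_Suc numeral_2_eq_2)
  show ?thesis
    unfolding covering_graph_def Let_def V all_pairs_def ugraph.simps by (simp only: adj)
qed

theorem lemma40:
  shows "boxicity (covering_graph [1, 1]) = 0 \<and> threshold_dim (covering_graph [1, 1]) = 0 \<and>
    (\<forall>m::nat. m \<ge> 1 \<longrightarrow>
       boxicity (covering_graph [m]) = (if m \<le> 3 then 0 else 1) \<and>
       threshold_dim (covering_graph [m]) = (if m \<le> 3 then 0 else 1))"
proof (intro conjI allI impI)
  show "boxicity (covering_graph [1, 1]) = 0" "threshold_dim (covering_graph [1, 1]) = 0"
    using edges_covering_graph_1_1
    by (simp_all add: boxicity_def threshold_dim_def is_intersection_of_0)
next
  fix m :: nat
  \<comment> \<open>The weights are distinct because \<open>hd\<close> is injective on one-entry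
    lists.\<close>
  have "interval_graph (covering_graph [m])"
    unfolding covering_graph_singleton by (rule interval_graph_T_graph) (auto intro: inj_onI)
  then show "boxicity (covering_graph [m]) = (if m \<le> 3 then 0 else 1)"
    unfolding boxicity_def
    by (simp only: Least_is_intersection_of simple_covering_graph
        covering_graph_singleton_complete_iff)
  have "threshold_graph (covering_graph [m])"
    unfolding covering_graph_singleton by (rule threshold_graph_T_graph) simp
  then show "threshold_dim (covering_graph [m]) = (if m \<le> 3 then 0 else 1)"
    unfolding threshold_dim_def
    by (simp only: Least_is_intersection_of simple_covering_graph
        covering_graph_singleton_complete_iff)
qed

end
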